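(* Let $N_m$ be the number of unordered partitions of $F_2^m$ into $2$-dimensional affine subspaces. Then, as $m\to\infty$, $$\frac{m}{2}\cdot 2^m + c_1\cdot 2^m + o(2^m)\ \le\ \log_2 N_m\ \le\ \frac{m}{2}\cdot 2^m + c_2\cdot 2^m + o(2^m),$$ where $c_1=-1-\frac34\log_2 e$ and $c_2=\frac{7}{16}-\frac{11}{16}\log_2 3$.
   Context: $F_2^m$ is the $m$-dimensional vector space over $F_2=\{0,1\}$. A $2$-dimensional affine subspace is a set $a\oplus S$ with $S$ a $2$-dimensional linear subspace; equivalently, a $4$-element set $\{x_1,x_2,x_3,x_4\}$ with $x_1\oplus x_2\oplus x_3\oplus x_4=\overline{0}$. An unordered partition is a partition in which the order of the parts does not matter. *)

theory Defs
  imports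
    Complex_Main
    "HOL-Library.Z2"
    "HOL-Library.Function_Algebras"
    "HOL-Library.Disjoint_Sets"
    "HOL-Library.Landau_Symbols"
begin

text \<open>
  The spaces of all dimensions \<open>m\<close> are realised inside the single vector space of
  sequences over the two-element field \<^typ>\<open>bit\<close> (with pointwise addition): a vector of length
  \<open>m\<close> is a sequence whose entries with index at least \<open>m\<close> vanish.
\<close>

definition F2_scale :: "bit \<Rightarrow> (nat \<Rightarrow> bit) \<Rightarrow> (nat \<Rightarrow> bit)" where
  "F2_scale c x = (\<lambda>i. c * x i)"

global_interpretation F2: vector_space F2_scale
  by unfold_locales (auto simp: F2_scale_def fun_eq_iff algebra_simps)

definition F2_space :: "nat \<Rightarrow> (nat \<Rightarrow> bit) set" where
  "F2_space m = {x. \<forall>i\<ge>m. x i = 0}"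

definition affine_plane :: "nat \<Rightarrow> (nat \<Rightarrow> bit) set \<Rightarrow> bool" where
  "affine_plane m A \<longleftrightarrow>
     (\<exists>a S. a \<in> F2_space m \<and> S \<subseteq> F2_space m \<and> F2.subspace S \<and> F2.dim S = 2 \<and>
            A = (\<lambda>x. a + x) ` S)"

definition num_plane_partitions :: "nat \<Rightarrow> nat" where
  "num_plane_partitions m =
     card {P. partition_on (F2_space m) P \<and> (\<forall>A\<in>P. affine_plane m A)}"

end

theory Submission
  imports
    Defs
    "HOL-Analysis.Convex"
    "HOL-Combinatorics.Permutations"
    "HOL-Real_Asymp.Real_Asymp"
begin

text \<open>
  Upper bound: build the partition greedily, covering one point at a time. With \<open>4 * j\<close> points left,
  the plane through a chosen point is determined by two further points, so at most \<open>(4 * j)\<^sup>2\<close>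
  choices arise. This gives the constant \<open>- log 2 (exp 1) / 2\<close>, which is smaller than \<open>c\<^sub>2\<close>.

  Lower bound: let \<open>G\<close> be a subspace of codimension 2 with \<open>q\<close> elements. Four permutations of \<open>G\<close>
  with pointwise sum 0 give a partition whose planes meet each coset of \<open>G\<close> once, and every
  partition arises from at most \<open>q!\<close> such quadruples. In characteristic 2 such a quadruple is a pair
  of pairs of permutations with the same pointwise sum. There are \<open>(q!)\<^sup>2\<close> pairs and at most
  \<open>q ^ q\<close> sums, so by Cauchy-Schwarz there are at least \<open>(q!) ^ 4 / q ^ q\<close> quadruples.
\<close>

subsection \<open>Affine planes over the two-element field\<close>

lemma F2_add_self [simp]: "x + x = (0 :: nat \<Rightarrow> bit)"
  by (simp add: fun_eq_iff)

lemma F2_add_self_left [simp]: "x + (x + y) = (y :: nat \<Rightarrow> bit)"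
  by (simp flip: add.assoc)

lemma F2_add_eq_0_iff [simp]: "x + y = 0 \<longleftrightarrow> x = (y :: nat \<Rightarrow> bit)"
  by (metis F2_add_self F2_add_self_left add.right_neutral)

lemma F2_diff_eq_add: "x - y = x + (y :: nat \<Rightarrow> bit)"
  by (simp add: fun_eq_iff)

lemma subspace_F2_space: "F2.subspace (F2_space m)"
  by (auto simp: F2.subspace_def F2_space_def F2_scale_def)

lemma F2_space_add: "x \<in> F2_space m \<Longrightarrow> y \<in> F2_space m \<Longrightarrow> x + y \<in> F2_space m"
  using subspace_F2_space by (rule F2.subspace_add)

lemma F2_scale_simps [simp]: "F2_scale 0 x = 0" "F2_scale 1 x = x"
  by (simp_all add: F2_scale_def fun_eq_iff)

lemma ex_bit: "(\<exists>k::bit. P k) \<longleftrightarrow> P 0 \<or> P 1"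
  by (metis bit_not_zero_iff)

text \<open>The only scalars are 0 and 1, so a new generator adds just one translate of the old
  span.\<close>

lemma F2_span_insert: "F2.span (insert a S) = F2.span S \<union> (+) a ` F2.span S"
proof -
  have "x \<in> F2.span (insert a S) \<longleftrightarrow> x \<in> F2.span S \<or> a + x \<in> F2.span S" for x
    by (simp add: F2.span_breakdown_eq ex_bit F2_diff_eq_add add.commute)
  moreover have "a + x \<in> F2.span S \<longleftrightarrow> x \<in> (+) a ` F2.span S" for x
    by (auto intro: image_eqI[of _ _ "a + x"])
  ultimately show ?thesis unfolding set_eq_iff Un_iff by blast
qed

lemma F2_span_pair: "F2.span {u, v} = {0, u, v, u + v}"
  by (auto simp: F2_span_insert)

text \<open>Over the two-element field two vectors form a basis of their span as soon as they are
  nonzero and distinct. This replaces subspaces and dimensions by explicit points from here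
  on.\<close>

lemma affine_plane_iff:
  "affine_plane m A \<longleftrightarrow> (\<exists>a u v. {a, u, v} \<subseteq> F2_space m \<and> u \<noteq> 0 \<and> v \<noteq> 0 \<and> u \<noteq> v \<and>
     A = {a, a + u, a + v, a + u + v})" (is "?L \<longleftrightarrow> ?R")
proof
  assume ?L
  then obtain a S where *: "a \<in> F2_space m" "S \<subseteq> F2_space m" "F2.subspace S" "F2.dim S = 2"
    "A = (\<lambda>x. a + x) ` S"
    unfolding affine_plane_def by blast
  obtain B where B: "B \<subseteq> S" "F2.independent B" "S \<subseteq> F2.span B" "card B = F2.dim S"
    using F2.basis_exists by blast
  have S: "S = F2.span B"
    using F2.span_subspace[OF B(1,3) *(3)] by simp
  from B(4) *(4) obtain u v where uv: "B = {u, v}" "u \<noteq> v"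
    by (auto simp: card_2_iff)
  have "u \<noteq> 0" "v \<noteq> 0" using B(2) F2.dependent_zero uv by blast+
  moreover have "{a, u, v} \<subseteq> F2_space m" using * B(1) uv by blast
  moreover have "A = {a, a + u, a + v, a + u + v}"
    unfolding *(5) S uv(1) F2_span_pair by (simp add: add.assoc)
  ultimately show ?R using uv(2) by blast
next
  assume ?R
  then obtain a u v where *: "{a, u, v} \<subseteq> F2_space m" "u \<noteq> 0" "v \<noteq> 0" "u \<noteq> v"
    "A = {a, a + u, a + v, a + u + v}" by blast
  have "u \<notin> F2.span {v}" "v \<notin> F2.span {}"
    using *(2-4) by (simp_all add: F2_span_insert)
  then have "F2.independent {u, v}"
    by (intro F2.independent_insertI F2.independent_empty)
  from F2.dim_span_eq_card_independent[OF this] have "F2.dim (F2.span {u, v}) = 2"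
    using *(4) by simp
  moreover have "F2.span {u, v} \<subseteq> F2_space m"
    using * F2.span_minimal subspace_F2_space by blast
  ultimately show ?L
    unfolding affine_plane_def using *(1) unfolding *(5)
    by (intro exI[of _ a] exI[of _ "F2.span {u, v}"])
       (use F2.subspace_span[of "{u, v}"] in \<open>simp add: F2_span_pair add.assoc\<close>)
qed

lemma affine_plane_card: "affine_plane m A \<Longrightarrow> card A = 4"
  by (auto simp: affine_plane_iff add.assoc)

text \<open>Any point of a plane can serve as its base point, and in characteristic 2 the fourth
  point is the sum of the other three.\<close>

lemma affine_plane_through:
  assumes "affine_plane m A" "x \<in> A"
  obtains y z where "y \<in> A" "z \<in> A" "A = {x, y, z, x + y + z}"
proof -
  from assms(1) obtain a u v where A: "A = {a, a + u, a + v, a + u + v}"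
    by (auto simp: affine_plane_iff)
  have "x + u \<in> A" "x + v \<in> A" "A = {x, x + u, x + v, x + (x + u) + (x + v)}"
    using assms(2) unfolding A by (auto simp: add_ac)
  then show thesis using that by blast
qed

lemma affine_planeI:
  assumes "{x, y, z} \<subseteq> F2_space m" "x \<noteq> y" "x \<noteq> z" "y \<noteq> z"
  shows "affine_plane m {x, y, z, x + y + z}"
  unfolding affine_plane_iff using assms
  \<comment> \<open>With base point \<open>x\<close>, the directions \<open>x + y\<close> and
    \<open>x + z\<close> lead to \<open>y\<close>, \<open>z\<close> and
    \<open>x + y + z\<close>.\<close>
  by (intro exI[of _ x] exI[of _ "x + y"] exI[of _ "x + z"])
     (auto simp: add_ac intro: F2_space_add)

lemma F2_space_card: "finite (F2_space m)" "card (F2_space m) = 2 ^ m"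
proof -
  \<comment> \<open>A vector is identified with its support.\<close>
  have "bij_betw (\<lambda>x. {i. x i = 1}) (F2_space m) (Pow {..<m})"
    by (rule bij_betw_byWitness[where f' = "\<lambda>I i. if i \<in> I then 1 else 0"])
       (auto simp: F2_space_def fun_eq_iff not_le[symmetric])
  from bij_betw_same_card[OF this] bij_betw_finite[OF this]
  show "finite (F2_space m)" "card (F2_space m) = 2 ^ m" by (simp_all add: card_Pow)
qed

subsection \<open>Upper bound\<close>

text \<open>The ground set is arbitrary because the greedy induction passes to \<open>X - A\<close>,
  which need not be a space.\<close>

definition plane_partitions :: "nat \<Rightarrow> (nat \<Rightarrow> bit) set \<Rightarrow> (nat \<Rightarrow> bit) set set set" where
  "plane_partitions m X = {P. partition_on X P \<and> (\<forall>A\<in>P. affine_plane m A)}"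

lemma finite_plane_partitions: "finite X \<Longrightarrow> finite (plane_partitions m X)"
  unfolding plane_partitions_def
  by (rule finite_subset[OF _ finitely_many_partition_on[of X]]) auto

text \<open>The part that contains \<open>x\<close> is one of the planes \<open>A\<close>; deleting
  it leaves a partition of \<open>X - A\<close>.\<close>

lemma plane_partitions_remove:
  assumes "x \<in> X"
  shows "plane_partitions m X \<subseteq>
    (\<Union>A\<in>{A. affine_plane m A \<and> x \<in> A \<and> A \<subseteq> X}. insert A ` plane_partitions m (X - A))"
proof
  fix P assume P: "P \<in> plane_partitions m X"
  then have part: "partition_on X P" and pl: "\<forall>A\<in>P. affine_plane m A"
    by (auto simp: plane_partitions_def)
  obtain A where A: "A \<in> P" "x \<in> A" using assms partition_onD1[OF part] by blast
  have "disjnt A (\<Union>(P - {A}))"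
    using partition_onD2[OF part] A(1) by (auto simp: disjnt_iff disjoint_def)
  from partition_on_insert[OF this, of X] A part
  have "partition_on (X - A) (P - {A})" "A \<subseteq> X" by (auto simp: insert_absorb)
  then have "P - {A} \<in> plane_partitions m (X - A)" "A \<subseteq> X" using pl
    by (auto simp: plane_partitions_def)
  moreover have "P = insert A (P - {A})" using A by blast
  ultimately show "P \<in> (\<Union>A\<in>{A. affine_plane m A \<and> x \<in> A \<and> A \<subseteq> X}.
      insert A ` plane_partitions m (X - A))"
    using A pl by blast
qed

text \<open>Ordered pairs of points of \<open>X\<close> map onto the planes. Each plane is
  overcounted, but \<open>c\<^sub>2\<close> leaves room for that.\<close>

lemma card_planes_through:
  assumes "finite X"
  shows "finite {A. affine_plane m A \<and> x \<in> A \<and> A \<subseteq> X}"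
    and "card {A. affine_plane m A \<and> x \<in> A \<and> A \<subseteq> X} \<le> card X ^ 2"
proof -
  show "finite {A. affine_plane m A \<and> x \<in> A \<and> A \<subseteq> X}"
    by (rule finite_subset[of _ "Pow X"]) (use assms in auto)
  have "{A. affine_plane m A \<and> x \<in> A \<and> A \<subseteq> X} \<subseteq> (\<lambda>(y, z). {x, y, z, x + y + z}) ` (X \<times> X)"
  proof
    fix A assume "A \<in> {A. affine_plane m A \<and> x \<in> A \<and> A \<subseteq> X}"
    then have "affine_plane m A" "x \<in> A" and sub: "A \<subseteq> X" by auto
    then obtain y z where yz: "y \<in> A" "z \<in> A" and A: "A = {x, y, z, x + y + z}"
      using affine_plane_through by blast
    show "A \<in> (\<lambda>(y, z). {x, y, z, x + y + z}) ` (X \<times> X)"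
      by (rule image_eqI[of _ _ "(y, z)"]) (use A yz sub in simp, use yz sub in blast)
  qed
  then have "card {A. affine_plane m A \<and> x \<in> A \<and> A \<subseteq> X} \<le> card (X \<times> X)"
    using assms by (meson card_image_le card_mono finite_SigmaI finite_imageI le_trans)
  then show "card {A. affine_plane m A \<and> x \<in> A \<and> A \<subseteq> X} \<le> card X ^ 2"
    by (simp add: card_cartesian_product power2_eq_square)
qed

text \<open>Each plane removes four points, so the choices multiply to at most the product of
  \<open>(4 * j)\<^sup>2\<close> over \<open>j\<close> from 1 to \<open>k\<close>.\<close>

lemma card_plane_partitions_le:
  assumes "finite X" "card X = 4 * k"
  shows "card (plane_partitions m X) \<le> 16 ^ k * fact k ^ 2"
  using assms
proof (induction k arbitrary: X)
  case 0
  then have "plane_partitions m X = {{}}"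
    by (auto simp: plane_partitions_def partition_on_empty)
  then show ?case by simp
next
  case (Suc k)
  then obtain x where x: "x \<in> X" by fastforce
  define \<A> where "\<A> = {A. affine_plane m A \<and> x \<in> A \<and> A \<subseteq> X}"
  have \<A>: "finite \<A>" "card \<A> \<le> card X ^ 2"
    using card_planes_through[OF Suc.prems(1)] by (simp_all add: \<A>_def)
  have "card (insert A ` plane_partitions m (X - A)) \<le> 16 ^ k * fact k ^ 2" if "A \<in> \<A>" for A
  proof -
    have "card (X - A) = 4 * k"
      using that Suc.prems affine_plane_card[of m A]
      by (subst card_Diff_subset) (auto simp: \<A>_def intro: finite_subset)
    with Suc.IH[of "X - A"] Suc.prems(1)
    have "card (plane_partitions m (X - A)) \<le> 16 ^ k * fact k ^ 2" by simp
    moreover have "card (insert A ` plane_partitions m (X - A)) \<le> card (plane_partitions m (X - A))"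
      using Suc.prems(1) by (intro card_image_le finite_plane_partitions) simp
    ultimately show ?thesis by linarith
  qed
  then have "(\<Sum>A\<in>\<A>. card (insert A ` plane_partitions m (X - A))) \<le> card \<A> * (16 ^ k * fact k ^ 2)"
    using sum_bounded_above[of \<A> "\<lambda>A. card (insert A ` plane_partitions m (X - A))"
        "16 ^ k * fact k ^ 2"] by simp
  also have "\<dots> \<le> card X ^ 2 * (16 ^ k * fact k ^ 2)"
    using \<A> by (intro mult_right_mono) auto
  also have "\<dots> = 16 ^ Suc k * fact (Suc k) ^ 2"
    by (simp only: Suc.prems(2) fact_Suc of_nat_id power_Suc power_mult_distrib) simp
  finally have "(\<Sum>A\<in>\<A>. card (insert A ` plane_partitions m (X - A))) \<le> 16 ^ Suc k * fact (Suc k) ^ 2" .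
  moreover have "card (plane_partitions m X) \<le> card (\<Union>A\<in>\<A>. insert A ` plane_partitions m (X - A))"
    unfolding \<A>_def using plane_partitions_remove[OF x] \<A> Suc.prems(1)
    by (intro card_mono) (auto simp: \<A>_def finite_plane_partitions)
  moreover have "\<dots> \<le> (\<Sum>A\<in>\<A>. card (insert A ` plane_partitions m (X - A)))"
    by (rule card_UN_le[OF \<A>(1)])
  ultimately show ?case by linarith
qed

subsection \<open>Lower bound\<close>

text \<open>Cauchy-Schwarz for the fibre sizes of \<open>f\<close>: they sum to
  \<open>card X\<close>, and their squares sum to the number of colliding pairs.\<close>

lemma card_collisions_ge:
  assumes "finite X" "finite Y" "f ` X \<subseteq> Y"
  shows "card X ^ 2 \<le> card Y * card {(a, b). a \<in> X \<and> b \<in> X \<and> f a = f b}"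
proof -
  define F where "F y = {a \<in> X. f a = y}" for y
  have fin: "finite (F y)" for y using assms(1) by (simp add: F_def)
  have "X = (\<Union>y\<in>Y. F y)" using assms(3) by (auto simp: F_def)
  then have "card X = card (\<Union>y\<in>Y. F y)" by simp
  also have "\<dots> = (\<Sum>y\<in>Y. card (F y))"
    using assms(2) fin by (subst card_UN_disjoint) (auto simp: F_def)
  finally have X: "card X = (\<Sum>y\<in>Y. card (F y))" .
  have "{(a, b). a \<in> X \<and> b \<in> X \<and> f a = f b} = (\<Union>y\<in>Y. F y \<times> F y)"
    using assms(3) by (auto simp: F_def)
  then have "card {(a, b). a \<in> X \<and> b \<in> X \<and> f a = f b} = card (\<Union>y\<in>Y. F y \<times> F y)" by simp
  also have "\<dots> = (\<Sum>y\<in>Y. card (F y \<times> F y))"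
    using assms(2) fin by (subst card_UN_disjoint) (auto simp: F_def)
  finally have C: "card {(a, b). a \<in> X \<and> b \<in> X \<and> f a = f b} = (\<Sum>y\<in>Y. card (F y) ^ 2)"
    by (simp add: card_cartesian_product power2_eq_square)
  have "(\<Sum>y\<in>Y. real (card (F y)))\<^sup>2 \<le> (\<Sum>y\<in>Y. (real (card (F y)))\<^sup>2) * real (card Y)"
    by (rule sum_squared_le_sum_of_squares)
  also have "\<dots> = real (card Y * (\<Sum>y\<in>Y. card (F y) ^ 2))" by simp
  finally have "real ((\<Sum>y\<in>Y. card (F y)) ^ 2) \<le> real (card Y * (\<Sum>y\<in>Y. card (F y) ^ 2))"
    by simp
  then show ?thesis unfolding X C by (simp only: of_nat_le_iff)
qed

section \<open>The four cosets of \<open>F2_space k\<close> in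
  \<open>F2_space (k + 2)\<close>\<close>

definition top_bits :: "nat \<Rightarrow> bit \<times> bit \<Rightarrow> nat \<Rightarrow> bit" where
  "top_bits k c = (\<lambda>i. if i = k then fst c else if i = Suc k then snd c else 0)"

lemma top_bits_in_space: "top_bits k c \<in> F2_space (k + 2)"
  by (auto simp: top_bits_def F2_space_def)

lemma F2_space_mono: "k \<le> m \<Longrightarrow> F2_space k \<subseteq> F2_space m"
  by (auto simp: F2_space_def)

text \<open>Elements of \<open>F2_space k\<close> vanish at coordinates \<open>k\<close> and
  \<open>k + 1\<close>, so the coset index can be read off there.\<close>

lemma top_bits_add_inject:
  assumes "g \<in> F2_space k" "g' \<in> F2_space k"
  shows "top_bits k c + g = top_bits k c' + g' \<longleftrightarrow> c = c' \<and> g = g'"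
proof
  assume *: "top_bits k c + g = top_bits k c' + g'"
  have "(top_bits k c + g) k = fst c" "(top_bits k c + g) (Suc k) = snd c"
       "(top_bits k c' + g') k = fst c'" "(top_bits k c' + g') (Suc k) = snd c'"
    using assms by (auto simp: top_bits_def F2_space_def)
  with * have "c = c'" by (metis prod_eqI)
  with * show "c = c' \<and> g = g'" by simp
qed simp

lemma top_bits_decompose:
  assumes "y \<in> F2_space (k + 2)"
  obtains c g where "g \<in> F2_space k" "y = top_bits k c + g"
proof
  define c where "c = (y k, y (Suc k))"
  show "(\<lambda>i. if i < k then y i else 0) \<in> F2_space k" by (simp add: F2_space_def)
  have "i \<ge> k + 2" if "\<not> i < k" "i \<noteq> k" "i \<noteq> Suc k" for i using that by simp
  then show "y = top_bits k c + (\<lambda>i. if i < k then y i else 0)"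
    using assms by (auto simp: fun_eq_iff top_bits_def c_def F2_space_def)
qed

section \<open>Partitions built from four permutations\<close>

definition block :: "nat \<Rightarrow> (bit \<times> bit \<Rightarrow> (nat \<Rightarrow> bit) \<Rightarrow> nat \<Rightarrow> bit) \<Rightarrow> (nat \<Rightarrow> bit) \<Rightarrow> (nat \<Rightarrow> bit) set" where
  "block k \<sigma> x = range (\<lambda>c. top_bits k c + \<sigma> c x)"

text \<open>In characteristic 2 the equation says that the four values sum to 0. Written as equality
  of two pair sums, it matches the collisions counted by \<open>card_collisions_ge\<close>.\<close>

definition zero_sum_perms :: "nat \<Rightarrow> (bit \<times> bit \<Rightarrow> (nat \<Rightarrow> bit) \<Rightarrow> nat \<Rightarrow> bit) set" where
  "zero_sum_perms k = {\<sigma>. (\<forall>c. \<sigma> c permutes F2_space k) \<and>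
     (\<forall>x\<in>F2_space k. \<sigma> (0, 0) x + \<sigma> (0, 1) x = \<sigma> (1, 0) x + \<sigma> (1, 1) x)}"

lemma UNIV_bit_pair: "(UNIV :: (bit \<times> bit) set) = {(0, 0), (0, 1), (1, 0), (1, 1)}"
proof -
  have "a \<in> {(0, 0), (0, 1), (1, 0), (1, 1)}" for a :: "bit \<times> bit"
    by (cases "fst a = 0"; cases "snd a = 0") (simp_all add: prod_eq_iff)
  then show ?thesis by blast
qed

lemma zero_sum_perms_permutes: "\<sigma> \<in> zero_sum_perms k \<Longrightarrow> \<sigma> c permutes F2_space k"
  unfolding zero_sum_perms_def by blast

lemma zero_sum_perms_in_space:
  "\<sigma> \<in> zero_sum_perms k \<Longrightarrow> x \<in> F2_space k \<Longrightarrow> \<sigma> c x \<in> F2_space k"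
  by (rule permutes_in_image[OF zero_sum_perms_permutes, THEN iffD2])

text \<open>A block has exactly one point in each coset. The case
  \<open>\<sigma>' = \<sigma>\<close> yields disjointness of blocks; the general case recovers the
  quadruple from its blocks.\<close>

lemma block_inject:
  assumes "\<sigma> \<in> zero_sum_perms k" "\<sigma>' \<in> zero_sum_perms k" "x \<in> F2_space k" "x' \<in> F2_space k"
    "top_bits k c + \<sigma> c x \<in> block k \<sigma>' x'"
  shows "\<sigma> c x = \<sigma>' c x'"
proof -
  from assms(5) obtain d where "top_bits k c + \<sigma> c x = top_bits k d + \<sigma>' d x'"
    unfolding block_def by blast
  then have "c = d \<and> \<sigma> c x = \<sigma>' d x'"
    by (rule top_bits_add_inject[OF zero_sum_perms_in_space[OF assms(1,3)]
          zero_sum_perms_in_space[OF assms(2,4)], THEN iffD1])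
  then show ?thesis by (elim conjE) (simp only:)
qed

lemma affine_plane_block:
  assumes \<sigma>: "\<sigma> \<in> zero_sum_perms k" and x: "x \<in> F2_space k"
  shows "affine_plane (k + 2) (block k \<sigma> x)"
proof -
  define p where "p c = top_bits k c + \<sigma> c x" for c
  have p: "p c \<in> F2_space (k + 2)" for c
    unfolding p_def using zero_sum_perms_in_space[OF \<sigma> x] F2_space_mono[OF le_add1]
    by (blast intro: F2_space_add top_bits_in_space)
  have ne: "p c \<noteq> p d" if "c \<noteq> d" for c d
    using that by (simp add: p_def top_bits_add_inject zero_sum_perms_in_space[OF \<sigma> x])
  \<comment> \<open>The coset representatives sum to 0, as do the four permuted values; hence so do
    the four points of the block.\<close>
  have "top_bits k (1, 1) = top_bits k (0, 0) + top_bits k (0, 1) + top_bits k (1, 0)"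
    by (auto simp: top_bits_def fun_eq_iff)
  moreover have "\<sigma> (0, 0) x + \<sigma> (0, 1) x = \<sigma> (1, 0) x + \<sigma> (1, 1) x"
    using \<sigma> x unfolding zero_sum_perms_def by blast
  then have "\<sigma> (1, 1) x = \<sigma> (0, 0) x + \<sigma> (0, 1) x + \<sigma> (1, 0) x"
    by (metis F2_add_self_left add.commute)
  ultimately have "p (1, 1) = p (0, 0) + p (0, 1) + p (1, 0)"
    by (simp only: p_def add_ac)
  then have "block k \<sigma> x = {p (0, 0), p (0, 1), p (1, 0), p (0, 0) + p (0, 1) + p (1, 0)}"
    unfolding block_def UNIV_bit_pair p_def[symmetric] by simp
  then show ?thesis
    using affine_planeI[of "p (0, 0)" "p (0, 1)" "p (1, 0)" "k + 2"] p ne by simp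
qed

text \<open>Surjectivity of each \<open>\<sigma> c\<close> makes the blocks cover the space, and
  injectivity makes them disjoint.\<close>

lemma blocks_in_plane_partitions:
  assumes \<sigma>: "\<sigma> \<in> zero_sum_perms k"
  shows "block k \<sigma> ` F2_space k \<in> plane_partitions (k + 2) (F2_space (k + 2))"
proof -
  have perm: "\<sigma> c permutes F2_space k" for c
    using \<sigma> by (rule zero_sum_perms_permutes)
  have pl: "\<forall>A\<in>block k \<sigma> ` F2_space k. affine_plane (k + 2) A"
    using affine_plane_block[OF \<sigma>] by blast
  have "partition_on (F2_space (k + 2)) (block k \<sigma> ` F2_space k)"
  proof (rule partition_onI)
    have "y \<in> \<Union>(block k \<sigma> ` F2_space k)" if y: "y \<in> F2_space (k + 2)" for y
    proof -
      obtain c g where "g \<in> F2_space k" "y = top_bits k c + g"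
        using top_bits_decompose[OF y] .
      moreover from this obtain x where "x \<in> F2_space k" "g = \<sigma> c x"
        using permutes_image[OF perm[of c]] by blast
      ultimately show ?thesis by (auto simp: block_def)
    qed
    moreover have "A \<subseteq> F2_space (k + 2)" if "A \<in> block k \<sigma> ` F2_space k" for A
      using pl that by (auto simp: affine_plane_iff intro!: F2_space_add)
    ultimately show "\<Union>(block k \<sigma> ` F2_space k) = F2_space (k + 2)" by blast
  next
    fix A B assume AB: "A \<in> block k \<sigma> ` F2_space k" "B \<in> block k \<sigma> ` F2_space k" "A \<noteq> B"
    then obtain x x' where x: "x \<in> F2_space k" "x' \<in> F2_space k" "A = block k \<sigma> x" "B = block k \<sigma> x'"
      by blast
    show "disjnt A B"
    proof (rule ccontr)
      assume "\<not> disjnt A B"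
      then obtain c where "top_bits k c + \<sigma> c x \<in> block k \<sigma> x'"
        by (auto simp: disjnt_iff x block_def)
      then have "\<sigma> c x = \<sigma> c x'" using block_inject[OF \<sigma> \<sigma>] x by blast
      then have "x = x'" using permutes_inj[OF perm] by (metis injD)
      with AB x show False by simp
    qed
  qed (auto simp: block_def)
  with pl show ?thesis by (simp add: plane_partitions_def)
qed

text \<open>The set of blocks forgets which \<open>x\<close> labels which block. Recording
  \<open>\<sigma> (0, 0)\<close> restores the labels, so a partition arises from at most
  \<open>fact (2 ^ k)\<close> quadruples.\<close>

lemma inj_on_blocks:
  "inj_on (\<lambda>\<sigma>. (block k \<sigma> ` F2_space k, \<sigma> (0, 0))) (zero_sum_perms k)"
proof (rule inj_onI)
  fix \<sigma> \<sigma>'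
  assume *: "\<sigma> \<in> zero_sum_perms k" "\<sigma>' \<in> zero_sum_perms k"
    "(block k \<sigma> ` F2_space k, \<sigma> (0, 0)) = (block k \<sigma>' ` F2_space k, \<sigma>' (0, 0))"
  have perm: "\<sigma> c permutes F2_space k" "\<sigma>' c permutes F2_space k" for c
    using *(1,2) by (auto dest: zero_sum_perms_permutes)
  have "\<sigma> c x = \<sigma>' c x" for c x
  proof (cases "x \<in> F2_space k")
    case True
    \<comment> \<open>A priori the same block may carry another label \<open>x'\<close> under
      \<open>\<sigma>'\<close>; the coset \<open>(0, 0)\<close> then forces
      \<open>x = x'\<close>.\<close>
    with * obtain x' where x': "x' \<in> F2_space k" "block k \<sigma> x = block k \<sigma>' x'" by blast
    then have "\<sigma> d x = \<sigma>' d x'" for d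
      using block_inject[OF *(1,2) True x'(1), of d] by (auto simp: block_def)
    moreover from this[of "(0, 0)"] * have "x = x'"
      using permutes_inj[OF perm(2)] by (metis injD prod.inject)
    ultimately show ?thesis by simp
  qed (simp add: permutes_not_in[OF perm(1)] permutes_not_in[OF perm(2)])
  then show "\<sigma> = \<sigma>'" by (simp add: fun_eq_iff)
qed

lemma blocks_image_subset:
  "(\<lambda>\<sigma>. (block k \<sigma> ` F2_space k, \<sigma> (0, 0))) ` zero_sum_perms k \<subseteq>
     plane_partitions (k + 2) (F2_space (k + 2)) \<times> {p. p permutes F2_space k}"
  using blocks_in_plane_partitions zero_sum_perms_permutes by blast

lemma finite_zero_sum_perms: "finite (zero_sum_perms k)"
  by (rule inj_on_finite[OF inj_on_blocks blocks_image_subset])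
     (intro finite_cartesian_product finite_plane_partitions F2_space_card finite_permutations)

section \<open>Counting zero-sum quadruples of permutations\<close>

lemma card_zero_sum_perms_le:
  "card (zero_sum_perms k) \<le> num_plane_partitions (k + 2) * fact (2 ^ k)"
proof -
  have "card (zero_sum_perms k) \<le>
      card (plane_partitions (k + 2) (F2_space (k + 2)) \<times> {p. p permutes F2_space k})"
    by (rule card_inj_on_le[OF inj_on_blocks blocks_image_subset])
       (intro finite_cartesian_product finite_plane_partitions F2_space_card finite_permutations)
  also have "\<dots> = num_plane_partitions (k + 2) * fact (2 ^ k)"
    by (simp add: card_cartesian_product card_permutations F2_space_card
        num_plane_partitions_def plane_partitions_def)
  finally show ?thesis .
qed

lemma card_zero_sum_perms_ge: "fact (2 ^ k) ^ 4 \<le> (2 ^ k) ^ 2 ^ k * card (zero_sum_perms k)"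
proof -
  define G where "G = F2_space k"
  define \<S> where "\<S> = {p. p permutes G}"
  \<comment> \<open>Restricting to \<open>G\<close> places the sums in
    \<open>G \<rightarrow>\<^sub>E G\<close>, which has only \<open>(2 ^ k) ^ 2 ^ k\<close>
    elements.\<close>
  define f :: "(_ \<Rightarrow> nat \<Rightarrow> bit) \<times> _ \<Rightarrow> _"
    where "f = (\<lambda>(p, q). restrict (\<lambda>x. p x + q x) G)"
  \<comment> \<open>The first bit selects the pair and the second the member, as in the equation of
    \<open>zero_sum_perms\<close>.\<close>
  define glue :: "((_ \<Rightarrow> nat \<Rightarrow> bit) \<times> _) \<times> _ \<times> _ \<Rightarrow> bit \<times> bit \<Rightarrow> (nat \<Rightarrow> bit) \<Rightarrow> nat \<Rightarrow> bit"
    where "glue = (\<lambda>((p, q), (r, s)) (a, b). if a = 0 then if b = 0 then p else q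
                     else if b = 0 then r else s)"
  let ?C = "{(a, b). a \<in> \<S> \<times> \<S> \<and> b \<in> \<S> \<times> \<S> \<and> f a = f b}"
  have G: "finite G" "card G = 2 ^ k" by (simp_all add: G_def F2_space_card)
  have \<S>: "finite \<S>" "card \<S> = fact (2 ^ k)"
    using G by (simp_all add: \<S>_def finite_permutations card_permutations)
  have "f ` (\<S> \<times> \<S>) \<subseteq> G \<rightarrow>\<^sub>E G"
    by (auto simp: f_def \<S>_def G_def permutes_in_image intro!: F2_space_add)
  from card_collisions_ge[OF _ _ this]
  have sq: "(fact (2 ^ k) * fact (2 ^ k)) ^ 2 \<le> (2 ^ k) ^ 2 ^ k * card ?C"
    using \<S> G by (simp add: finite_PiE card_funcsetE card_cartesian_product)
  have "card ?C = card (glue ` ?C)"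
  proof (rule card_image[symmetric], rule inj_onI)
    fix u v assume "glue u = glue v"
    then have "glue u c = glue v c" for c by simp
    from this[of "(0, 0)"] this[of "(0, 1)"] this[of "(1, 0)"] this[of "(1, 1)"]
    show "u = v" by (auto simp: glue_def split: prod.splits)
  qed
  moreover have "glue ` ?C \<subseteq> zero_sum_perms k"
  proof
    fix \<sigma> assume "\<sigma> \<in> glue ` ?C"
    then obtain u v where "\<sigma> = glue (u, v)" "u \<in> \<S> \<times> \<S>" "v \<in> \<S> \<times> \<S>" "f u = f v"
      by blast
    moreover obtain p q r s where "u = (p, q)" "v = (r, s)" by (metis surj_pair)
    ultimately have *: "\<sigma> = glue ((p, q), (r, s))" "p \<in> \<S>" "q \<in> \<S>" "r \<in> \<S>" "s \<in> \<S>"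
      "f (p, q) = f (r, s)" by simp_all
    from *(6) have "p x + q x = r x + s x" if "x \<in> G" for x
      using that by (metis (no_types, lifting) f_def case_prod_conv restrict_apply')
    with * show "\<sigma> \<in> zero_sum_perms k"
      by (auto simp: zero_sum_perms_def glue_def \<S>_def G_def)
  qed
  ultimately have "card ?C \<le> card (zero_sum_perms k)"
    using card_mono[OF finite_zero_sum_perms] by simp
  from order_trans[OF sq mult_le_mono2[OF this]]
  have "(fact (2 ^ k) * fact (2 ^ k)) ^ 2 \<le> (2 ^ k) ^ 2 ^ k * card (zero_sum_perms k)" .
  then show ?thesis by (simp add: power_mult_distrib flip: power_add)
qed

lemma num_plane_partitions_ge:
  "fact (2 ^ k) ^ 3 \<le> (2 ^ k) ^ 2 ^ k * num_plane_partitions (k + 2)"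
proof -
  \<comment> \<open>One factorial is split off to cancel against the multiplicity in
    \<open>card_zero_sum_perms_le\<close>.\<close>
  have "fact (2 ^ k) * fact (2 ^ k) ^ 3 \<le> (2 ^ k) ^ 2 ^ k * card (zero_sum_perms k)"
    using card_zero_sum_perms_ge[of k] by (simp flip: power_Suc)
  also have "\<dots> \<le> (2 ^ k) ^ 2 ^ k * (num_plane_partitions (k + 2) * fact (2 ^ k))"
    by (intro mult_left_mono card_zero_sum_perms_le) simp
  finally have "fact (2 ^ k) * fact (2 ^ k) ^ 3
      \<le> fact (2 ^ k) * ((2 ^ k) ^ 2 ^ k * num_plane_partitions (k + 2))"
    by (simp add: mult_ac)
  then show ?thesis by (simp only: mult_le_cancel1 fact_gt_zero)
qed

lemma num_plane_partitions_le: "num_plane_partitions (k + 2) \<le> 16 ^ 2 ^ k * fact (2 ^ k) ^ 2"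
  using card_plane_partitions_le[of "F2_space (k + 2)" "2 ^ k" "k + 2"]
  by (simp add: F2_space_card num_plane_partitions_def plane_partitions_def)

subsection \<open>Asymptotics\<close>

text \<open>A weak form of Stirling's formula. At \<open>n = 2 ^ k\<close> the gap
  \<open>ln n + 1\<close> is linear in \<open>k\<close>, hence negligible against
  \<open>2 ^ k\<close>.\<close>

lemma ln_fact_bounds:
  assumes "n \<ge> 1"
  shows "real n * ln (real n) - real n \<le> ln (fact n)"
    and "ln (fact n) \<le> real n * ln (real n) - real n + ln (real n) + 1"
proof -
  have "real n * ln (real n) - real n \<le> ln (fact n) \<and>
    ln (fact n) \<le> real n * ln (real n) - real n + ln (real n) + 1"
    using assms
  proof (induction n rule: dec_induct)
    case (step n)
    then have n: "real n > 0" by simp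
    \<comment> \<open>The induction rests on \<open>n * ?d \<le> 1 \<le> (n + 1) * ?d\<close>; the
      left half serves the lower bound, the right half the upper one.\<close>
    let ?d = "ln (real (Suc n)) - ln (real n)"
    have "?d = ln (real (Suc n) / real n)"
      using n by (subst ln_div) auto
    also have "real (Suc n) / real n = 1 + 1 / real n"
      using n by (simp add: field_simps)
    finally have "?d = ln (1 + 1 / real n)" .
    also have "\<dots> \<le> 1 / real n" using n by (intro ln_add_one_self_le_self) simp
    finally have 1: "real n * ?d \<le> 1" using n by (simp add: field_simps)
    have "- ?d = ln (real n / real (Suc n))"
      using n by (simp add: ln_div)
    also have "\<dots> \<le> real n / real (Suc n) - 1" using n by (intro ln_le_minus_one) simp
    finally have "real (Suc n) * ?d \<ge> real (Suc n) * (1 - real n / real (Suc n))"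
      by (intro mult_left_mono) auto
    also have "real (Suc n) * (1 - real n / real (Suc n)) = 1" by (simp add: field_simps)
    finally have 2: "real (Suc n) * ?d \<ge> 1" .
    have "ln (fact (Suc n)) = ln (real (Suc n)) + ln (fact n)"
      using ln_mult[of "real (Suc n)" "fact n"] by simp
    with step.IH 1 2 show ?case by (simp add: algebra_simps del: fact_Suc)
  qed auto
  then show "real n * ln (real n) - real n \<le> ln (fact n)"
    "ln (fact n) \<le> real n * ln (real n) - real n + ln (real n) + 1" by auto
qed

text \<open>Multiplied out by \<open>16 * ln 2\<close>, this is the comparison of the greedy
  constant \<open>- log 2 (exp 1) / 2\<close> with \<open>c\<^sub>2\<close>.\<close>

lemma eleven_ln_3_le: "11 * ln 3 \<le> 7 * ln 2 + (8 :: real)"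
proof -
  \<comment> \<open>The estimate 1 + 1 + 1/2 for e is sharp enough, as
    \<open>3 ^ 11 = 177147\<close> while \<open>2 ^ 7 * (5 / 2) ^ 8\<close> exceeds 195000.\<close>
  have "(5 / 2 :: real) \<le> exp 1" using exp_lower_Taylor_quadratic[of 1] by simp
  then have "(5 / 2 :: real) ^ 8 \<le> exp 1 ^ 8" by (intro power_mono) auto
  then have "2 ^ 7 * (5 / 2) ^ 8 \<le> 2 ^ 7 * (exp 1 ^ 8 :: real)" by (intro mult_left_mono) auto
  moreover have "(3 :: real) ^ 11 \<le> 2 ^ 7 * (5 / 2) ^ 8" by (simp add: power_divide)
  ultimately have "(3 :: real) ^ 11 \<le> 2 ^ 7 * exp 1 ^ 8" by (rule order_trans[rotated])
  then have "ln ((3 :: real) ^ 11) \<le> ln (2 ^ 7 * exp 1 ^ 8)" by (subst ln_le_cancel_iff) auto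
  moreover have "ln ((3 :: real) ^ 11) = 11 * ln 3" "ln (2 ^ 7 * exp 1 ^ 8) = 7 * ln 2 + (8 :: real)"
    by (simp_all only: ln_mult ln_realpow zero_less_power zero_less_numeral exp_gt_zero
        mult_eq_0_iff power_eq_0_iff exp_not_eq_zero) simp_all
  ultimately show ?thesis by (simp only:)
qed

text \<open>Here \<open>real k * ln 2\<close> is the logarithm of \<open>2 ^ k\<close>, so both main
  terms are \<open>2 * q * ln q\<close> with \<open>q = 2 ^ k\<close>.\<close>

lemma log_num_plane_partitions_bounds:
  fixes k :: nat
  defines "L \<equiv> ln (real (num_plane_partitions (k + 2)))"
  shows "2 * 2 ^ k * (real k * ln 2) - 3 * 2 ^ k \<le> L"
    and "L \<le> 2 * 2 ^ k * (real k * ln 2) + 4 * 2 ^ k * ln 2 - 2 * 2 ^ k + 2 * (real k * ln 2) + 2"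
proof -
  let ?N = "real (num_plane_partitions (k + 2))"
  note fb = ln_fact_bounds[of "2 ^ k", simplified, unfolded ln_realpow[of 2, simplified]]
  have ge: "fact (2 ^ k) ^ 3 \<le> (2 ^ k) ^ 2 ^ k * ?N"
    using num_plane_partitions_ge[of k, folded of_nat_le_iff[where 'a = real]] by simp
  \<comment> \<open>Existence of a partition, needed for taking logarithms, already follows from the
    lower bound.\<close>
  have N: "?N > 0"
    using order.strict_trans2[OF zero_less_power[OF fact_gt_zero] ge]
    by (simp add: zero_less_mult_iff)
  have "ln (fact (2 ^ k) ^ 3) \<le> ln ((2 ^ k) ^ 2 ^ k * ?N)"
    using ge N by (subst ln_le_cancel_iff) auto
  then have "3 * ln (fact (2 ^ k)) \<le> 2 ^ k * (real k * ln 2) + L"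
    using N by (simp add: ln_mult ln_realpow L_def)
  with fb(1) show "2 * 2 ^ k * (real k * ln 2) - 3 * 2 ^ k \<le> L" by linarith
  have le: "?N \<le> 16 ^ 2 ^ k * fact (2 ^ k) ^ 2"
    using num_plane_partitions_le[of k, folded of_nat_le_iff[where 'a = real]] by simp
  have "L \<le> ln (16 ^ 2 ^ k * fact (2 ^ k) ^ 2)"
    unfolding L_def using le N by (subst ln_le_cancel_iff) auto
  also have "\<dots> = 2 ^ k * ln 16 + 2 * ln (fact (2 ^ k))"
    by (simp add: ln_mult ln_realpow)
  also have "ln (16 :: real) = 4 * ln 2"
    using ln_realpow[of "2 :: real" 4] by simp
  finally show "L \<le> 2 * 2 ^ k * (real k * ln 2) + 4 * 2 ^ k * ln 2 - 2 * 2 ^ k + 2 * (real k * ln 2) + 2"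
    using fb(2) by linarith
qed

theorem theorem5:
  fixes c\<^sub>1 c\<^sub>2 :: real
  assumes c1: "c\<^sub>1 = - 1 - 3 / 4 * log 2 (exp 1)"
    and c2: "c\<^sub>2 = 7 / 16 - 11 / 16 * log 2 3"
  shows "\<exists>f g :: nat \<Rightarrow> real.
    f \<in> o(\<lambda>m. 2 ^ m) \<and> g \<in> o(\<lambda>m. 2 ^ m) \<and>
    (\<forall>\<^sub>F m in sequentially.
       real m / 2 * 2 ^ m + c\<^sub>1 * 2 ^ m + f m \<le> log 2 (real (num_plane_partitions m)) \<and>
       log 2 (real (num_plane_partitions m)) \<le> real m / 2 * 2 ^ m + c\<^sub>2 * 2 ^ m + g m)"
proof (intro exI conjI)
  \<comment> \<open>The lower bound holds with no error term.\<close>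
  show "(\<lambda>m. 0 :: real) \<in> o(\<lambda>m. 2 ^ m)" by simp
  \<comment> \<open>This is \<open>2 * (real k * ln 2) + 2\<close> from the factorial estimate,
    divided by \<open>ln 2\<close> and with \<open>k\<close> enlarged to \<open>m\<close>.\<close>
  show "(\<lambda>m. 2 * real m + 2 / ln 2) \<in> o(\<lambda>m. 2 ^ m)" by real_asymp
  have l2: "ln (2 :: real) > 0" by simp
  show "\<forall>\<^sub>F m in sequentially.
       real m / 2 * 2 ^ m + c\<^sub>1 * 2 ^ m + 0 \<le> log 2 (real (num_plane_partitions m)) \<and>
       log 2 (real (num_plane_partitions m)) \<le> real m / 2 * 2 ^ m + c\<^sub>2 * 2 ^ m + (2 * real m + 2 / ln 2)"
  proof (rule eventually_sequentiallyI[of 2])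
    fix m :: nat assume "2 \<le> m"
    then obtain k where m: "m = k + 2" by (metis add.commute le_Suc_ex)
    define L where "L = ln (real (num_plane_partitions m))"
    define K :: real where "K = 2 ^ k"
    have K: "2 ^ m = 4 * K" "K > 0" by (simp_all add: m K_def)
    have bounds: "2 * K * (real k * ln 2) - 3 * K \<le> L"
      "L \<le> 2 * K * (real k * ln 2) + 4 * K * ln 2 - 2 * K + 2 * (real k * ln 2) + 2"
      using log_num_plane_partitions_bounds[of k] by (simp_all add: L_def K_def m)
    \<comment> \<open>The \<open>- 1\<close> in \<open>c\<^sub>1\<close> offsets
      \<open>m = k + 2\<close>, and its second term becomes exactly \<open>- 3 * K\<close>.\<close>
    have "(real m / 2 * (4 * K) + c\<^sub>1 * (4 * K)) * ln 2 = 2 * K * (real k * ln 2) - 3 * K"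
      using l2 by (simp add: c1 m log_def field_simps)
    moreover have "2 * K * (real k * ln 2) + 4 * K * ln 2 - 2 * K + 2 * (real k * ln 2) + 2
      \<le> (real m / 2 * (4 * K) + c\<^sub>2 * (4 * K) + (2 * real m + 2 / ln 2)) * ln 2"
    proof -
      \<comment> \<open>The slack is a multiple of the difference in \<open>eleven_ln_3_le\<close>,
        plus \<open>4 * ln 2\<close> from replacing \<open>k\<close> by \<open>m\<close> in the
        error term.\<close>
      have "(real m / 2 * (4 * K) + c\<^sub>2 * (4 * K) + (2 * real m + 2 / ln 2)) * ln 2
        - (2 * K * (real k * ln 2) + 4 * K * ln 2 - 2 * K + 2 * (real k * ln 2) + 2)
        = K * (7 * ln 2 + 8 - 11 * ln 3) / 4 + 4 * ln 2"
        using l2 by (simp add: c2 m log_def field_simps)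
      moreover have "K * (7 * ln 2 + 8 - 11 * ln 3) / 4 \<ge> 0"
        using eleven_ln_3_le K(2) by simp
      ultimately show ?thesis using l2 by linarith
    qed
    ultimately have
      "(real m / 2 * (4 * K) + c\<^sub>1 * (4 * K)) * ln 2 \<le> L"
      "L \<le> (real m / 2 * (4 * K) + c\<^sub>2 * (4 * K) + (2 * real m + 2 / ln 2)) * ln 2"
      using bounds by linarith+
    then show "real m / 2 * 2 ^ m + c\<^sub>1 * 2 ^ m + 0 \<le> log 2 (real (num_plane_partitions m)) \<and>
       log 2 (real (num_plane_partitions m)) \<le> real m / 2 * 2 ^ m + c\<^sub>2 * 2 ^ m + (2 * real m + 2 / ln 2)"
      using l2 by (simp add: log_def K(1) pos_le_divide_eq pos_divide_le_eq flip: L_def)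
  qed
qed

end
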